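(* Let $\beta\ge 0$. The mean-variance optimization problem $\eta^*=\min_{d\in\mathcal D}\{\beta\sigma^d-\mu^d\}$ is equivalent to a bilevel MDP problem in which, for each fixed $y\in\mathbb R$, the inner problem is a standard long-run average MDP with cost function $\beta(r(i,a)-y)^2-r(i,a)$: $$\eta^*=\min_{d\in\mathcal D}\{\beta\sigma^d-\mu^d\}=\min_{y\in\mathbb R}\ \min_{d\in\mathcal D}\{\beta\tilde\sigma^d(y)-\mu^d\}.$$
   Context: MDP setting. $\mathcal S=\{1,\dots,S\}$ is a finite state space, $\mathcal A$ is a finite nonempty action space, $p(j|i,a)$ is the probability of moving from state $i$ to state $j$ under action $a$, and $r(i,a)\in\mathbb R$ is the reward. $\mathcal D$ is the (finite) set of stationary deterministic policies $d:\mathcal S\to\mathcal A$. For $d\in\mathcal D$, $\bm P^d$ is the $S\times S$ transition matrix with entries $p(j|i,d(i))$. Standing assumption: for every $d\in\mathcal D$ the Markov chain with matrix $\bm P^d$ is a unichain (a single recurrent class plus possibly transient states), so it has a unique stationary distribution $\bm\pi^d=(\pi^d(i))_{i\in\mathcal S}$, with $\bm\pi^d\bm P^d=\bm\pi^d$ and $\sum_i\pi^d(i)=1$. Long-run mean: $\mu^d=\sum_{i\in\mathcal S}\pi^d(i)\,r(i,d(i))$. Long-run (steady-state) variance: $\sigma^d=\sum_{i\in\mathcal S}\pi^d(i)\,(r(i,d(i))-\mu^d)^2$ (note that $\sigma^d$ denotes the variance itself). Pseudo variance with pseudo mean $y\in\mathbb R$: $\tilde\sigma^d(y)=\sum_{i\in\mathcal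 S}\pi^d(i)\,(r(i,d(i))-y)^2$. The standard long-run average MDP with cost function $c(i,a)$ is the problem of minimizing $\sum_{i\in\mathcal S}\pi^d(i)\,c(i,d(i))$ over $d\in\mathcal D$. *)

theory Defs
  imports "HOL-Analysis.Analysis"
begin

definition accessible :: "real ^ 's::finite ^ 's \<Rightarrow> 's \<Rightarrow> 's \<Rightarrow> bool" where
  "accessible P i j \<longleftrightarrow> (i, j) \<in> {(k, l). P $ k $ l > 0}\<^sup>*"

definition communicate :: "real ^ 's::finite ^ 's \<Rightarrow> 's \<Rightarrow> 's \<Rightarrow> bool" where
  "communicate P i j \<longleftrightarrow> accessible P i j \<and> accessible P j i"

text \<open>\<open>first_passage P j n i\<close> is the probability that the chain with transition matrix \<open>P\<close>,
  started in \<open>i\<close>, visits \<open>j\<close> at time \<open>n + 1\<close> for the first time after time 0.\<close>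

primrec first_passage :: "real ^ 's::finite ^ 's \<Rightarrow> 's \<Rightarrow> nat \<Rightarrow> 's \<Rightarrow> real" where
  "first_passage P j 0 i = P $ i $ j"
| "first_passage P j (Suc n) i = (\<Sum>k\<in>UNIV - {j}. P $ i $ k * first_passage P j n k)"

text \<open>Recurrence: the chain returns to \<open>i\<close> with probability one.\<close>

definition recurrent :: "real ^ 's::finite ^ 's \<Rightarrow> 's \<Rightarrow> bool" where
  "recurrent P i \<longleftrightarrow> (\<lambda>n. first_passage P i n i) sums 1"

definition recurrent_class :: "real ^ 's::finite ^ 's \<Rightarrow> 's set \<Rightarrow> bool" where
  "recurrent_class P C \<longleftrightarrow> (\<exists>i. recurrent P i \<and> C = {j. communicate P i j})"

definition unichain :: "real ^ 's::finite ^ 's \<Rightarrow> bool" where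
  "unichain P \<longleftrightarrow> (\<exists>!C. recurrent_class P C)"

definition is_stationary_distribution :: "real ^ 's::finite ^ 's \<Rightarrow> real ^ 's \<Rightarrow> bool" where
  "is_stationary_distribution P \<pi> \<longleftrightarrow>
     (\<forall>i. \<pi> $ i \<ge> 0) \<and> (\<Sum>i\<in>UNIV. \<pi> $ i) = 1 \<and> \<pi> v* P = \<pi>"

text \<open>Meaningful only for matrices with exactly one stationary distribution, in particular for
  stochastic matrices that are unichain.\<close>

definition stationary_distribution :: "real ^ 's::finite ^ 's \<Rightarrow> real ^ 's" where
  "stationary_distribution P = (THE \<pi>. is_stationary_distribution P \<pi>)"

text \<open>In a Markov decision process, \<open>p i a j\<close> is the probability of moving from state \<open>i\<close> to
  state \<open>j\<close> under action \<open>a\<close>.\<close>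

definition is_transition_law :: "('s::finite \<Rightarrow> 'a \<Rightarrow> 's \<Rightarrow> real) \<Rightarrow> bool" where
  "is_transition_law p \<longleftrightarrow> (\<forall>i a. (\<forall>j. p i a j \<ge> 0) \<and> (\<Sum>j\<in>UNIV. p i a j) = 1)"

definition transition_matrix ::
    "('s::finite \<Rightarrow> 'a \<Rightarrow> 's \<Rightarrow> real) \<Rightarrow> ('s \<Rightarrow> 'a) \<Rightarrow> real ^ 's ^ 's" where
  "transition_matrix p d = (\<chi> i j. p i (d i) j)"

abbreviation steady_state ::
    "('s::finite \<Rightarrow> 'a \<Rightarrow> 's \<Rightarrow> real) \<Rightarrow> ('s \<Rightarrow> 'a) \<Rightarrow> real ^ 's" where
  "steady_state p d \<equiv> stationary_distribution (transition_matrix p d)"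

text \<open>The objective of the standard long-run average decision problem with cost function \<open>c\<close>.\<close>

definition long_run_average ::
    "('s::finite \<Rightarrow> 'a \<Rightarrow> 's \<Rightarrow> real) \<Rightarrow> ('s \<Rightarrow> 'a \<Rightarrow> real) \<Rightarrow> ('s \<Rightarrow> 'a) \<Rightarrow> real" where
  "long_run_average p c d = (\<Sum>i\<in>UNIV. steady_state p d $ i * c i (d i))"

definition long_run_mean ::
    "('s::finite \<Rightarrow> 'a \<Rightarrow> 's \<Rightarrow> real) \<Rightarrow> ('s \<Rightarrow> 'a \<Rightarrow> real) \<Rightarrow> ('s \<Rightarrow> 'a) \<Rightarrow> real" where
  "long_run_mean p r d = (\<Sum>i\<in>UNIV. steady_state p d $ i * r i (d i))"

definition long_run_variance ::
    "('s::finite \<Rightarrow> 'a \<Rightarrow> 's \<Rightarrow> real) \<Rightarrow> ('s \<Rightarrow> 'a \<Rightarrow> real) \<Rightarrow> ('s \<Rightarrow> 'a) \<Rightarrow> real" where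
  "long_run_variance p r d =
     (\<Sum>i\<in>UNIV. steady_state p d $ i * (r i (d i) - long_run_mean p r d)\<^sup>2)"

definition pseudo_variance ::
    "('s::finite \<Rightarrow> 'a \<Rightarrow> 's \<Rightarrow> real) \<Rightarrow> ('s \<Rightarrow> 'a \<Rightarrow> real) \<Rightarrow> ('s \<Rightarrow> 'a) \<Rightarrow> real \<Rightarrow> real" where
  "pseudo_variance p r d y = (\<Sum>i\<in>UNIV. steady_state p d $ i * (r i (d i) - y)\<^sup>2)"

text \<open>An attained minimum over an arbitrary, possibly infinite domain, where \<^const>\<open>Min\<close> is
  not applicable and an infimum would not assert attainment.\<close>

definition has_minimum :: "('b \<Rightarrow> real) \<Rightarrow> real \<Rightarrow> bool" where
  "has_minimum f m \<longleftrightarrow> (\<exists>x. f x = m) \<and> (\<forall>x. m \<le> f x)"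

end

theory Submission
  imports Defs
begin

text \<open>The bilevel formulation rests on the bias-variance identity
  \<open>E (R - y)\<^sup>2 = Var R + (E R - y)\<^sup>2\<close>, taken under the steady state of a policy: the pseudo variance
  dominates the variance, with equality when the pseudo mean \<open>y\<close> is the true mean of that policy.
  So minimizing over \<open>y\<close> and over policies commutes, and at an optimal policy the optimal \<open>y\<close> is its
  mean (\<open>has_minimum_of_penalized_minima\<close>).

  The identity needs the steady state weights to sum to one. These weights are a definite
  description, so the substance of the proof is that a unichain stochastic matrix has exactly one
  stationary distribution, with recurrence understood through first passage probabilities.
  The key is that for a stochastic matrix \<open>P\<close> the positive part of a solution of \<open>v v* P = v\<close> is
  again a solution (\<open>positive_part_invariant\<close>), because \<open>P\<close> preserves total mass. This gives
  both halves. For existence, \<open>P\<close> has the eigenvalue 1 (with right eigenvector \<open>1\<close>), hence also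
  a left eigenvector for it, and the positive part of this eigenvector or of its negative can be
  normalized. For uniqueness, the difference of two stationary
  distributions has a nonempty positive and a nonempty negative support; both supports are closed
  under accessibility, and each nonempty closed set of states contains a recurrent state
  (\<open>closed_set_contains_recurrent\<close>), so there would be two recurrent classes.\<close>

section \<open>Recurrent states of a finite chain\<close>

definition stochastic_matrix :: "real ^ 's::finite ^ 's \<Rightarrow> bool" where
  "stochastic_matrix P \<longleftrightarrow> (\<forall>i j. P $ i $ j \<ge> 0) \<and> (\<forall>i. (\<Sum>j\<in>UNIV. P $ i $ j) = 1)"

lemma accessible_refl: "accessible P i i"
  by (simp add: accessible_def)

lemma accessible_trans: "accessible P i j \<Longrightarrow> accessible P j k \<Longrightarrow> accessible P i k"
  unfolding accessible_def by (rule rtrancl_trans)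

lemma accessible_step: "P $ i $ j > 0 \<Longrightarrow> accessible P i j"
  unfolding accessible_def by (rule r_into_rtrancl) simp

lemma accessible_closed:
  assumes "accessible P i j" and "i \<in> A"
    and "\<And>k l. k \<in> A \<Longrightarrow> P $ k $ l > 0 \<Longrightarrow> l \<in> A"
  shows "j \<in> A"
  using assms(1) unfolding accessible_def
  by (induction rule: rtrancl_induct) (use assms in auto)

lemma first_passage_nonneg:
  assumes "stochastic_matrix P"
  shows "first_passage P j n i \<ge> 0"
  using assms unfolding stochastic_matrix_def
  by (induction n arbitrary: i) (auto intro!: sum_nonneg mult_nonneg_nonneg)

text \<open>Conditioning on the first step of the chain.\<close>

lemma first_passage_partial_sum_step:
  "(\<Sum>n<Suc N. first_passage P j n i) =
     P $ i $ j + (\<Sum>k\<in>UNIV - {j}. P $ i $ k * (\<Sum>n<N. first_passage P j n k))"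
proof -
  have "(\<Sum>n<Suc N. first_passage P j n i) =
      P $ i $ j + (\<Sum>n<N. \<Sum>k\<in>UNIV - {j}. P $ i $ k * first_passage P j n k)"
    by (subst sum.lessThan_Suc_shift) simp
  also have "(\<Sum>n<N. \<Sum>k\<in>UNIV - {j}. P $ i $ k * first_passage P j n k) =
      (\<Sum>k\<in>UNIV - {j}. P $ i $ k * (\<Sum>n<N. first_passage P j n k))"
    by (subst sum.swap) (simp add: sum_distrib_left)
  finally show ?thesis .
qed

lemma stochastic_row_split:
  assumes "stochastic_matrix P"
  shows "P $ i $ j + (\<Sum>k\<in>UNIV - {j}. P $ i $ k) = 1"
  using assms sum.remove[of UNIV j "\<lambda>k. P $ i $ k"] unfolding stochastic_matrix_def by simp

lemma first_passage_partial_sum_le_1: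
  assumes "stochastic_matrix P"
  shows "(\<Sum>n<N. first_passage P j n i) \<le> 1"
proof (induction N arbitrary: i)
  case 0
  then show ?case by simp
next
  case (Suc N)
  have "(\<Sum>k\<in>UNIV - {j}. P $ i $ k * (\<Sum>n<N. first_passage P j n k))
      \<le> (\<Sum>k\<in>UNIV - {j}. P $ i $ k)"
    using assms Suc unfolding stochastic_matrix_def
    by (intro sum_mono) (simp add: mult_left_le)
  then show ?case
    unfolding first_passage_partial_sum_step using stochastic_row_split[OF assms, of i j] by linarith
qed

lemma first_passage_summable:
  assumes "stochastic_matrix P"
  shows "summable (\<lambda>n. first_passage P j n i)"
  using first_passage_partial_sum_le_1[OF assms] first_passage_nonneg[OF assms]
  by (intro summableI_nonneg_bounded[where x = 1]) auto

lemma hitting_probability_step: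
  assumes "stochastic_matrix P"
  shows "(\<Sum>n. first_passage P j n i) =
     P $ i $ j + (\<Sum>k\<in>UNIV - {j}. P $ i $ k * (\<Sum>n. first_passage P j n k))"
proof (rule LIMSEQ_unique)
  have lim: "(\<lambda>N. \<Sum>n<N. first_passage P j n k) \<longlonglongrightarrow> (\<Sum>n. first_passage P j n k)" for k
    using first_passage_summable[OF assms] by (rule summable_LIMSEQ)
  show "(\<lambda>N. \<Sum>n<Suc N. first_passage P j n i) \<longlonglongrightarrow> (\<Sum>n. first_passage P j n i)"
    by (rule LIMSEQ_Suc[OF lim])
  show "(\<lambda>N. \<Sum>n<Suc N. first_passage P j n i) \<longlonglongrightarrow>
      P $ i $ j + (\<Sum>k\<in>UNIV - {j}. P $ i $ k * (\<Sum>n. first_passage P j n k))"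
    unfolding first_passage_partial_sum_step by (intro tendsto_intros lim)
qed

text \<open>The escape probability \<open>g k = 1 - P\<^sub>k(hit i)\<close> satisfies \<open>g k = (\<Sum>l\<noteq>i. P\<^sub>k\<^sub>l * g l)\<close>, so
  a maximum principle applies among the states accessible from \<open>i\<close>: if the maximum were positive,
  the states attaining it would be closed under transitions and none of them could step to \<open>i\<close>,
  although \<open>i\<close> can be reached from them.\<close>

lemma recurrent_if_accessible_back:
  fixes P :: "real ^ 's::finite ^ 's"
  assumes P: "stochastic_matrix P"
    and returns: "\<And>j. accessible P i j \<Longrightarrow> accessible P j i"
  shows "recurrent P i"
proof -
  define g where "g k = 1 - (\<Sum>n. first_passage P i n k)" for k
  define C where "C = {j. accessible P i j}"
  define M where "M = Max (g ` C)"
  define X where "X = {k \<in> C. g k = M}"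
  have nonneg: "P $ k $ l \<ge> 0" for k l
    using P by (simp add: stochastic_matrix_def)
  have g_nonneg: "g k \<ge> 0" for k
    unfolding g_def
    using suminf_le_const[OF first_passage_summable[OF P] first_passage_partial_sum_le_1[OF P]]
    by simp
  have g_step: "g k = (\<Sum>l\<in>UNIV - {i}. P $ k $ l * g l)" for k
  proof -
    have "g k = (\<Sum>l\<in>UNIV - {i}. P $ k $ l)
        - (\<Sum>l\<in>UNIV - {i}. P $ k $ l * (\<Sum>n. first_passage P i n l))"
      using hitting_probability_step[OF P, of i k] stochastic_row_split[OF P, of k i]
      unfolding g_def by linarith
    also have "\<dots> = (\<Sum>l\<in>UNIV - {i}. P $ k $ l * g l)"
      unfolding g_def by (simp add: right_diff_distrib sum_subtractf)
    finally show ?thesis .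
  qed
  have iC: "i \<in> C"
    by (simp add: C_def accessible_refl)
  have C_closed: "l \<in> C" if "k \<in> C" "P $ k $ l > 0" for k l
    using that accessible_trans accessible_step unfolding C_def by blast
  have g_le: "g k \<le> M" if "k \<in> C" for k
    unfolding M_def using that by simp
  have "M \<le> 0"
  proof (rule ccontr)
    assume "\<not> M \<le> 0"
    then have M: "M > 0" by simp
    have term_le: "P $ k $ l * g l \<le> P $ k $ l * M" if "k \<in> C" for k l
    proof (cases "P $ k $ l > 0")
      case True
      then show ?thesis using g_le C_closed that by (simp add: mult_left_mono)
    next
      case False
      then show ?thesis using nonneg[of k l] by simp
    qed
    have mass: "(\<Sum>l\<in>UNIV - {i}. P $ k $ l * M) = (1 - P $ k $ i) * M" for k
      using stochastic_row_split[OF P, of k i] by (simp add: sum_distrib_right[symmetric])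
    have no_step: "P $ k $ i = 0" if "k \<in> X" for k
    proof -
      have "M = g k" and "k \<in> C"
        using that by (auto simp: X_def)
      then have "M \<le> (1 - P $ k $ i) * M"
        unfolding mass[symmetric] using g_step[of k] term_le by (simp add: sum_mono)
      then have "P $ k $ i * M \<le> 0" by (simp add: algebra_simps)
      then show ?thesis using M nonneg[of k i] by (simp add: mult_le_0_iff)
    qed
    have X_closed: "l \<in> X" if "k \<in> X" "P $ k $ l > 0" for k l
    proof -
      have kC: "k \<in> C" and gk: "g k = M" using that by (auto simp: X_def)
      have li: "l \<noteq> i" using no_step[OF \<open>k \<in> X\<close>] that by auto
      have "(\<Sum>m\<in>UNIV - {i}. P $ k $ m * g m) = (\<Sum>m\<in>UNIV - {i}. P $ k $ m * M)"
        unfolding mass no_step[OF \<open>k \<in> X\<close>] g_step[symmetric] gk by simp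
      then have "P $ k $ l * g l = P $ k $ l * M"
        using sum_mono_inv[of "\<lambda>m. P $ k $ m * g m" "UNIV - {i}" "\<lambda>m. P $ k $ m * M" l]
          term_le[OF kC] li by auto
      then show ?thesis
        using that C_closed[OF kC] by (auto simp: X_def)
    qed
    have "M \<in> g ` C"
      unfolding M_def using iC by (intro Max_in) auto
    then obtain k where k: "k \<in> X" by (auto simp: X_def)
    then have "accessible P k i"
      using returns by (auto simp: X_def C_def)
    then have iX: "i \<in> X"
      using k X_closed by (rule accessible_closed)
    have "\<exists>l. P $ i $ l > 0"
    proof (rule ccontr)
      assume "\<nexists>l. P $ i $ l > 0"
      then have "P $ i $ l = 0" for l
        using nonneg[of i l] by (auto simp: not_less intro: antisym)
      then have "(\<Sum>l\<in>UNIV. P $ i $ l) = 0"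
        by simp
      then show False
        using P by (auto simp: stochastic_matrix_def)
    qed
    then obtain l where l: "P $ i $ l > 0" ..
    \<comment> \<open>A genuine return path of positive length is needed, since its last step is what contradicts
      \<open>no_step\<close>.\<close>
    then have "(l, i) \<in> {(k, l). P $ k $ l > 0}\<^sup>*"
      using returns accessible_step unfolding accessible_def by blast
    then have "(i, i) \<in> {(k, l). P $ k $ l > 0}\<^sup>+"
      using l by (intro rtrancl_into_trancl2) simp
    then obtain m where m: "(i, m) \<in> {(k, l). P $ k $ l > 0}\<^sup>*" "P $ m $ i > 0"
      by (auto dest: tranclD2)
    then have "m \<in> X"
      using iX X_closed by (intro accessible_closed[of P i m]) (auto simp: accessible_def)
    then show False
      using no_step m by simp
  qed
  then have "g i = 0"
    using g_le[OF iC] g_nonneg[of i] by simp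
  then show ?thesis
    unfolding recurrent_def g_def using summable_sums[OF first_passage_summable[OF P], of i i] by simp
qed

text \<open>Choose a state of \<open>A\<close> from which the fewest states are accessible. No move from it can lose an
  accessible state, so it can be reached again from wherever the chain goes.\<close>

lemma closed_set_contains_recurrent:
  fixes P :: "real ^ 's::finite ^ 's"
  assumes P: "stochastic_matrix P" and "A \<noteq> {}"
    and closed: "\<And>k l. k \<in> A \<Longrightarrow> P $ k $ l > 0 \<Longrightarrow> l \<in> A"
  obtains i where "i \<in> A" and "recurrent P i"
proof -
  obtain i where i: "i \<in> A"
    and minimal: "\<And>j. j \<in> A \<Longrightarrow> card {k. accessible P i k} \<le> card {k. accessible P j k}"
    using ex_has_least_nat[of "\<lambda>i. i \<in> A" _ "\<lambda>i. card {k. accessible P i k}"] \<open>A \<noteq> {}\<close> by blast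
  have "accessible P j i" if "accessible P i j" for j
  proof -
    have "j \<in> A"
      using that i closed by (rule accessible_closed)
    moreover have "{k. accessible P j k} \<subseteq> {k. accessible P i k}"
      using accessible_trans[OF that] by blast
    ultimately have "{k. accessible P j k} = {k. accessible P i k}"
      using minimal by (intro card_seteq) auto
    then show ?thesis
      using accessible_refl[of P i] by blast
  qed
  then show thesis
    using that i recurrent_if_accessible_back[OF P] by blast
qed

section \<open>The stationary distribution of a unichain\<close>

text \<open>Componentwise \<open>v\<^sup>+ \<le> v\<^sup>+ P\<close>, and both sides have the same total mass because \<open>P\<close> has row
  sums one.\<close>

lemma positive_part_invariant:
  fixes P :: "real ^ 's::finite ^ 's"
  assumes P: "stochastic_matrix P" and v: "v v* P = v"
  shows "(\<chi> i. max (v $ i) 0) v* P = (\<chi> i. max (v $ i) 0)"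
proof -
  define w where "w i = max (v $ i) 0" for i
  have nonneg: "P $ i $ j \<ge> 0" for i j
    using P by (simp add: stochastic_matrix_def)
  have le: "w j \<le> (\<Sum>i\<in>UNIV. w i * P $ i $ j)" for j
  proof -
    have "v $ j = (\<Sum>i\<in>UNIV. v $ i * P $ i $ j)"
      by (subst v[symmetric]) (simp add: vector_matrix_mult_def)
    also have "\<dots> \<le> (\<Sum>i\<in>UNIV. w i * P $ i $ j)"
      using nonneg by (intro sum_mono mult_right_mono) (auto simp: w_def)
    finally show ?thesis
      using nonneg by (auto simp: w_def intro!: sum_nonneg mult_nonneg_nonneg)
  qed
  have "(\<Sum>j\<in>UNIV. \<Sum>i\<in>UNIV. w i * P $ i $ j) = (\<Sum>i\<in>UNIV. w i * (\<Sum>j\<in>UNIV. P $ i $ j))"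
    by (subst sum.swap) (simp add: sum_distrib_left)
  also have "\<dots> = (\<Sum>i\<in>UNIV. w i)"
    using P by (simp add: stochastic_matrix_def)
  finally have "w j = (\<Sum>i\<in>UNIV. w i * P $ i $ j)" for j
    using le by (intro sum_mono_inv[of w UNIV "\<lambda>j. \<Sum>i\<in>UNIV. w i * P $ i $ j"]) auto
  from this[symmetric] show ?thesis
    by (simp add: vec_eq_iff vector_matrix_mult_def w_def)
qed

lemma positive_support_closed:
  fixes P :: "real ^ 's::finite ^ 's"
  assumes P: "stochastic_matrix P" and v: "v v* P = v"
    and "v $ k > 0" and "P $ k $ l > 0"
  shows "v $ l > 0"
proof -
  have "max (v $ k) 0 * P $ k $ l \<le> (\<Sum>i\<in>UNIV. max (v $ i) 0 * P $ i $ l)"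
    using P by (intro member_le_sum) (auto simp: stochastic_matrix_def)
  also have "\<dots> = max (v $ l) 0"
    using positive_part_invariant[OF P v] by (simp add: vec_eq_iff vector_matrix_mult_def)
  finally have "v $ k * P $ k $ l \<le> max (v $ l) 0"
    using assms(3) by simp
  moreover have "0 < v $ k * P $ k $ l"
    using assms(3,4) by simp
  ultimately show ?thesis
    by linarith
qed

lemma stationary_distribution_of_invariant_vector:
  fixes P :: "real ^ 's::finite ^ 's"
  assumes P: "stochastic_matrix P" and v: "v v* P = v" and pos: "v $ i > 0"
  shows "\<exists>\<pi>. is_stationary_distribution P \<pi>"
proof -
  define w where "w = (\<chi> i. max (v $ i) 0)"
  define s where "s = (\<Sum>i\<in>UNIV. w $ i)"
  have "s > 0"
    unfolding s_def by (rule sum_pos2[of _ i]) (use pos in \<open>auto simp: w_def\<close>)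
  have "(\<Sum>i\<in>UNIV. w $ i * P $ i $ j) = w $ j" for j
    using positive_part_invariant[OF P v] unfolding w_def[symmetric]
    by (simp add: vec_eq_iff vector_matrix_mult_def)
  then have "(\<chi> i. w $ i / s) v* P = (\<chi> i. w $ i / s)"
    by (simp add: vec_eq_iff vector_matrix_mult_def sum_divide_distrib[symmetric])
  moreover have "(\<Sum>i\<in>UNIV. w $ i / s) = 1"
    unfolding sum_divide_distrib[symmetric] s_def[symmetric] using \<open>s > 0\<close> by simp
  moreover have "w $ i / s \<ge> 0" for i
    using \<open>s > 0\<close> by (simp add: w_def)
  ultimately have "is_stationary_distribution P (\<chi> i. w $ i / s)"
    by (simp add: is_stationary_distribution_def)
  then show ?thesis ..
qed

lemma stationary_distribution_exists:
  fixes P :: "real ^ 's::finite ^ 's"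
  assumes P: "stochastic_matrix P"
  shows "\<exists>\<pi>. is_stationary_distribution P \<pi>"
proof -
  \<comment> \<open>The constant vector is in the kernel of \<open>P - I\<close>, so this matrix is singular, and its transpose
    as well.\<close>
  have "(P - mat 1) *v (\<chi> i. 1) = 0"
    using P by (simp add: stochastic_matrix_def vec_eq_iff matrix_vector_mult_diff_rdistrib
        matrix_vector_mult_def[of P])
  moreover have "(\<chi> i. 1) \<noteq> (0 :: real ^ 's)"
    by (simp add: vec_eq_iff)
  ultimately have "rank (P - mat 1) \<noteq> CARD('s)"
    using matrix_nonfull_linear_equations_eq by blast
  then have "rank (transpose (P - mat 1)) \<noteq> CARD('s)"
    by (simp only: rank_transpose not_False_eq_True)
  then obtain v where "v \<noteq> 0" and "transpose (P - mat 1) *v v = 0"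
    using matrix_nonfull_linear_equations_eq by blast
  then have v: "v v* P = v"
    by (simp add: vector_matrix_mult_diff_rdistrib)
  then have neg: "(- v) v* P = - v"
    by (simp add: vec_eq_iff vector_matrix_mult_def sum_negf)
  obtain i where "v $ i \<noteq> 0"
    using \<open>v \<noteq> 0\<close> by (auto simp: vec_eq_iff)
  then consider "v $ i > 0" | "(- v) $ i > 0"
    by fastforce
  then show ?thesis
    using stationary_distribution_of_invariant_vector[OF P] v neg by metis
qed

text \<open>For distinct \<open>\<pi>\<close> and \<open>\<rho>\<close>, the sets where \<open>\<pi> > \<rho>\<close> and where \<open>\<rho> > \<pi>\<close> are disjoint, closed
  and nonempty, so each would carry its own recurrent class.\<close>

lemma stationary_distribution_unique:
  fixes P :: "real ^ 's::finite ^ 's"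
  assumes P: "stochastic_matrix P" and "unichain P"
    and \<pi>: "is_stationary_distribution P \<pi>" and \<rho>: "is_stationary_distribution P \<rho>"
  shows "\<pi> = \<rho>"
proof (rule ccontr)
  assume "\<pi> \<noteq> \<rho>"
  have recurrent_above: "\<exists>i. \<sigma> $ i > \<tau> $ i \<and> recurrent P i \<and>
      (\<forall>j. accessible P i j \<longrightarrow> \<sigma> $ j > \<tau> $ j)"
    if \<sigma>: "is_stationary_distribution P \<sigma>" and \<tau>: "is_stationary_distribution P \<tau>"
      and "\<sigma> \<noteq> \<tau>" for \<sigma> \<tau>
  proof -
    define A where "A = {i. \<sigma> $ i > \<tau> $ i}"
    have "(\<sigma> - \<tau>) v* P = \<sigma> - \<tau>"
      using \<sigma> \<tau> by (simp add: is_stationary_distribution_def vector_matrix_mult_diff_distrib)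
    then have closed: "l \<in> A" if "k \<in> A" "P $ k $ l > 0" for k l
      using positive_support_closed[OF P, of "\<sigma> - \<tau>" k l] that by (simp add: A_def)
    have "A \<noteq> {}"
    proof
      assume "A = {}"
      then have "\<sigma> $ i \<le> \<tau> $ i" for i
        by (auto simp: A_def not_less)
      moreover have "(\<Sum>i\<in>UNIV. \<sigma> $ i) = (\<Sum>i\<in>UNIV. \<tau> $ i)"
        using \<sigma> \<tau> by (simp add: is_stationary_distribution_def)
      ultimately have "\<sigma> $ i = \<tau> $ i" for i
        by (intro sum_mono_inv[of "\<lambda>i. \<sigma> $ i" UNIV "\<lambda>i. \<tau> $ i"]) auto
      then show False
        using \<open>\<sigma> \<noteq> \<tau>\<close> by (simp add: vec_eq_iff)
    qed
    then obtain i where "i \<in> A" "recurrent P i"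
      using P closed by (elim closed_set_contains_recurrent)
    moreover have "j \<in> A" if "accessible P i j" for j
      using that \<open>i \<in> A\<close> closed by (rule accessible_closed)
    ultimately show ?thesis
      by (auto simp: A_def)
  qed
  obtain i where i: "recurrent P i" "\<And>j. accessible P i j \<Longrightarrow> \<pi> $ j > \<rho> $ j"
    using recurrent_above[OF \<pi> \<rho> \<open>\<pi> \<noteq> \<rho>\<close>] by blast
  obtain j where j: "recurrent P j" "\<rho> $ j > \<pi> $ j"
    using recurrent_above[OF \<rho> \<pi>] \<open>\<pi> \<noteq> \<rho>\<close> by blast
  have "{k. communicate P i k} = {k. communicate P j k}"
    using \<open>unichain P\<close> i(1) j(1) unfolding unichain_def recurrent_class_def by blast
  then have "accessible P i j"
    using accessible_refl[of P j] unfolding communicate_def by blast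
  then show False
    using i(2) j(2) by fastforce
qed

lemma unichain_stationary_distribution:
  assumes "stochastic_matrix P" and "unichain P"
  shows "is_stationary_distribution P (stationary_distribution P)"
proof -
  have "\<exists>!\<pi>. is_stationary_distribution P \<pi>"
    using stationary_distribution_exists[OF assms(1)] stationary_distribution_unique[OF assms]
    by blast
  then show ?thesis
    unfolding stationary_distribution_def by (rule theI')
qed

section \<open>The bilevel formulation\<close>

lemma stochastic_transition_matrix:
  "is_transition_law p \<Longrightarrow> stochastic_matrix (transition_matrix p d)"
  by (simp add: is_transition_law_def stochastic_matrix_def transition_matrix_def)

lemma pseudo_variance_eq_variance_plus_bias:
  assumes "(\<Sum>i\<in>UNIV. steady_state p d $ i) = 1"
  shows "pseudo_variance p r d y = long_run_variance p r d + (long_run_mean p r d - y)\<^sup>2"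
proof -
  let ?q = "\<lambda>i. steady_state p d $ i" and ?m = "long_run_mean p r d"
  \<comment> \<open>Expanding the square leaves a cross term that vanishes, the mean deviation from the mean
    being zero.\<close>
  have "pseudo_variance p r d y = (\<Sum>i\<in>UNIV. ?q i * (r i (d i) - ?m)\<^sup>2
      + 2 * (?m - y) * (?q i * r i (d i)) - 2 * (?m - y) * ?m * ?q i + (?m - y)\<^sup>2 * ?q i)"
    unfolding pseudo_variance_def
    by (intro sum.cong) (auto simp: power2_eq_square algebra_simps)
  also have "\<dots> = long_run_variance p r d + 2 * (?m - y) * ?m
      - 2 * (?m - y) * ?m * (\<Sum>i\<in>UNIV. ?q i) + (?m - y)\<^sup>2 * (\<Sum>i\<in>UNIV. ?q i)"
    by (simp only: sum.distrib sum_subtractf sum_distrib_left[symmetric]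
        long_run_variance_def long_run_mean_def)
  finally show ?thesis
    using assms by simp
qed

text \<open>Two minimizations commute; here \<open>m d\<close> is the value of the outer variable at which the penalty
  of \<open>d\<close> vanishes.\<close>

lemma has_minimum_of_penalized_minima:
  fixes f :: "'d::finite \<Rightarrow> real" and g :: "'d \<Rightarrow> 'y \<Rightarrow> real"
  assumes "\<And>d y. f d \<le> g d y" and "\<And>d. g d (m d) = f d"
  shows "has_minimum (\<lambda>y. MIN d. g d y) (MIN d. f d)"
proof -
  have lower: "(MIN d. f d) \<le> (MIN d. g d y)" for y
  proof (rule Min.boundedI)
    fix a assume "a \<in> range (\<lambda>d. g d y)"
    then obtain d where "a = g d y" by blast
    moreover have "(MIN d. f d) \<le> f d" by simp
    ultimately show "(MIN d. f d) \<le> a"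
      using assms(1)[of d y] by linarith
  qed auto
  have "(MIN d. f d) \<in> range f"
    by (intro Min_in) auto
  then obtain d where "(MIN d. f d) = f d" by blast
  moreover have "(MIN e. g e (m d)) \<le> g d (m d)" by simp
  ultimately have "(MIN e. g e (m d)) = (MIN d. f d)"
    using lower[of "m d"] assms(2)[of d] by linarith
  then show ?thesis
    unfolding has_minimum_def using lower by blast
qed

theorem lemma1:
  fixes p :: "'s::finite \<Rightarrow> 'a::finite \<Rightarrow> 's \<Rightarrow> real"
    and r :: "'s \<Rightarrow> 'a \<Rightarrow> real"
    and \<beta> :: real
  assumes "is_transition_law p"
    and "\<And>d :: 's \<Rightarrow> 'a. unichain (transition_matrix p d)"
    and "\<beta> \<ge> 0"
  shows "(\<forall>y d. \<beta> * pseudo_variance p r d y - long_run_mean p r d =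
            long_run_average p (\<lambda>i a. \<beta> * (r i a - y)\<^sup>2 - r i a) d) \<and>
         has_minimum (\<lambda>y. MIN d. \<beta> * pseudo_variance p r d y - long_run_mean p r d)
           (MIN d. \<beta> * long_run_variance p r d - long_run_mean p r d)"
proof (intro conjI allI)
  fix y d
  show "\<beta> * pseudo_variance p r d y - long_run_mean p r d =
      long_run_average p (\<lambda>i a. \<beta> * (r i a - y)\<^sup>2 - r i a) d"
    unfolding pseudo_variance_def long_run_mean_def long_run_average_def
    by (simp add: right_diff_distrib sum_subtractf sum_distrib_left mult.left_commute)
next
  have "(\<Sum>i\<in>UNIV. steady_state p d $ i) = 1" for d
    using unichain_stationary_distribution[OF stochastic_transition_matrix[OF assms(1)] assms(2)]
    by (simp add: is_stationary_distribution_def)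
  note bias = pseudo_variance_eq_variance_plus_bias[OF this]
  show "has_minimum (\<lambda>y. MIN d. \<beta> * pseudo_variance p r d y - long_run_mean p r d)
      (MIN d. \<beta> * long_run_variance p r d - long_run_mean p r d)"
    by (rule has_minimum_of_penalized_minima[where m = "long_run_mean p r"])
      (use \<open>\<beta> \<ge> 0\<close> in \<open>auto simp: bias intro!: mult_left_mono\<close>)
qed

end
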